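(* Let $n\ge1$. For any polynomial $f\in\mathcal{H}_{n,3}$ and any integer $r\ge 2$, one has $$f_{\Delta(n,r)}-\underline{f}\le\left(\frac{4}{r}-\frac{4}{r^2}\right)(\overline{f}-\underline{f}).$$
   Context: $\mathbb{N}=\{0,1,2,\dots\}$. $\mathcal{H}_{n,d}$ is the set of homogeneous polynomials of degree $d$ in $n$ variables with real coefficients. The standard simplex is $\Delta_n=\{x\in\mathbb{R}_+^n:\sum_{i=1}^n x_i=1\}$; $\underline{f}=\min_{x\in\Delta_n}f(x)$ and $\overline{f}=\max_{x\in\Delta_n}f(x)$. The regular grid is $\Delta(n,r)=\{x\in\Delta_n: rx\in\mathbb{N}^n\}$ and $f_{\Delta(n,r)}=\min_{x\in\Delta(n,r)}f(x)$. *)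

theory Defs
  imports "HOL-Analysis.Analysis" "HOL-Library.Poly_Mapping"
begin

text \<open>
  The \<open>n\<close> variables are indexed by a finite type \<open>'n\<close> with \<open>CARD('n) = n\<close>, so \<open>n \<ge> 1\<close> holds
  automatically. A polynomial maps finitely many monomials (exponent vectors) to nonzero
  real coefficients.
\<close>

type_synonym 'n mpol = "('n \<Rightarrow>\<^sub>0 nat) \<Rightarrow>\<^sub>0 real"

definition mpol_eval :: "'n::finite mpol \<Rightarrow> real ^ 'n \<Rightarrow> real" where
  "mpol_eval f x =
     (\<Sum>m \<in> Poly_Mapping.keys f.
        Poly_Mapping.lookup f m * (\<Prod>i\<in>UNIV. (x $ i) ^ Poly_Mapping.lookup m i))"

definition hom_polys :: "nat \<Rightarrow> 'n::finite mpol set" where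
  "hom_polys d = {f. \<forall>m \<in> Poly_Mapping.keys f. (\<Sum>i\<in>UNIV. Poly_Mapping.lookup m i) = d}"

definition std_simplex :: "(real ^ 'n::finite) set" where
  "std_simplex = {x. (\<forall>i. 0 \<le> x $ i) \<and> (\<Sum>i\<in>UNIV. x $ i) = 1}"

text \<open>For \<open>r = 0\<close> this is the whole simplex; only \<open>r \<ge> 1\<close> is meaningful.\<close>

definition simplex_grid :: "nat \<Rightarrow> (real ^ 'n::finite) set" where
  "simplex_grid r = {x \<in> std_simplex. \<forall>i. real r * x $ i \<in> \<nat>}"

text \<open>
  Minimum and maximum in the literal sense (not infimum and supremum); the lemmas below
  show that they are attained in all the cases of interest.
\<close>

definition min_on :: "('a \<Rightarrow> real) \<Rightarrow> 'a set \<Rightarrow> real" where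
  "min_on g S = (LEAST v. v \<in> g ` S)"

definition max_on :: "('a \<Rightarrow> real) \<Rightarrow> 'a set \<Rightarrow> real" where
  "max_on g S = (GREATEST v. v \<in> g ` S)"

lemma min_on_eqI:
  assumes "x \<in> S" and "\<And>y. y \<in> S \<Longrightarrow> g x \<le> g y"
  shows "min_on g S = g x"
  unfolding min_on_def by (rule Least_equality) (use assms in auto)

lemma max_on_eqI:
  assumes "x \<in> S" and "\<And>y. y \<in> S \<Longrightarrow> g y \<le> g x"
  shows "max_on g S = g x"
  unfolding max_on_def by (rule Greatest_equality) (use assms in auto)

lemma continuous_on_mpol_eval: "continuous_on S (mpol_eval f)"
  unfolding mpol_eval_def by (intro continuous_intros)

lemma compact_std_simplex: "compact (std_simplex :: (real ^ 'n::finite) set)"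
proof -
  have "closed {x :: real ^ 'n. (\<forall>i. 0 \<le> x $ i) \<and> (\<Sum>i\<in>UNIV. x $ i) = 1}"
    by (intro closed_Collect_conj closed_Collect_all closed_Collect_le closed_Collect_eq
        continuous_intros)
  moreover have "norm x \<le> 1" if "x \<in> std_simplex" for x :: "real ^ 'n"
    using norm_le_l1_cart[of x] that by (simp add: std_simplex_def)
  ultimately show ?thesis
    unfolding compact_eq_bounded_closed bounded_iff by (auto simp: std_simplex_def)
qed

lemma axis_in_simplex_grid: "axis i 1 \<in> simplex_grid r"
  by (auto simp: simplex_grid_def std_simplex_def axis_def if_distrib)

lemma std_simplex_nonempty: "(std_simplex :: (real ^ 'n::finite) set) \<noteq> {}"
  using axis_in_simplex_grid by (auto simp: simplex_grid_def)

lemma finite_simplex_grid: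
  assumes "r \<ge> 1"
  shows "finite (simplex_grid r :: (real ^ 'n::finite) set)"
proof (rule finite_subset)
  show "finite ((\<lambda>k :: 'n \<Rightarrow> nat. \<chi> i. real (k i) / real r) ` (UNIV \<rightarrow>\<^sub>E {..r}))"
    by (intro finite_imageI finite_PiE) auto
  show "simplex_grid r \<subseteq> (\<lambda>k :: 'n \<Rightarrow> nat. \<chi> i. real (k i) / real r) ` (UNIV \<rightarrow>\<^sub>E {..r})"
  proof
    fix x :: "real ^ 'n"
    assume x: "x \<in> simplex_grid r"
    then have "\<forall>i. \<exists>k. real r * x $ i = real k"
      by (auto simp: simplex_grid_def elim: Nats_cases)
    then obtain k where k: "\<And>i. real r * x $ i = real (k i)"
      by metis
    have "x $ i \<le> 1" for i
      using x member_le_sum[of i UNIV "\<lambda>i. x $ i"]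
      by (auto simp: simplex_grid_def std_simplex_def)
    then have "real (k i) \<le> real r" for i
      using k[of i] mult_left_mono[of "x $ i" 1 "real r"] by simp
    then have "k \<in> UNIV \<rightarrow>\<^sub>E {..r}"
      by auto
    moreover have "x = (\<chi> i. real (k i) / real r)"
      using k assms by (simp add: vec_eq_iff field_simps)
    ultimately show "x \<in> (\<lambda>k :: 'n \<Rightarrow> nat. \<chi> i. real (k i) / real r) ` (UNIV \<rightarrow>\<^sub>E {..r})"
      by blast
  qed
qed

lemma min_on_std_simplex_attained:
  obtains x where "x \<in> std_simplex" and "min_on (mpol_eval f) std_simplex = mpol_eval f x"
    and "\<And>y. y \<in> std_simplex \<Longrightarrow> mpol_eval f x \<le> mpol_eval f y"
proof -
  obtain x where "x \<in> std_simplex" "\<forall>y\<in>std_simplex. mpol_eval f x \<le> mpol_eval f y"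
    using continuous_attains_inf[OF compact_std_simplex std_simplex_nonempty
        continuous_on_mpol_eval] by blast
  then show thesis
    by (intro that[of x] min_on_eqI) auto
qed

lemma max_on_std_simplex_attained:
  obtains x where "x \<in> std_simplex" and "max_on (mpol_eval f) std_simplex = mpol_eval f x"
    and "\<And>y. y \<in> std_simplex \<Longrightarrow> mpol_eval f y \<le> mpol_eval f x"
proof -
  obtain x where "x \<in> std_simplex" "\<forall>y\<in>std_simplex. mpol_eval f y \<le> mpol_eval f x"
    using continuous_attains_sup[OF compact_std_simplex std_simplex_nonempty
        continuous_on_mpol_eval] by blast
  then show thesis
    by (intro that[of x] max_on_eqI) auto
qed

lemma min_on_simplex_grid_attained:
  assumes "r \<ge> 1"
  obtains x where "x \<in> simplex_grid r"
    and "min_on (mpol_eval f) (simplex_grid r) = mpol_eval f x"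
    and "\<And>y. y \<in> simplex_grid r \<Longrightarrow> mpol_eval f x \<le> mpol_eval f y"
proof -
  have "simplex_grid r \<noteq> {}"
    using axis_in_simplex_grid by blast
  then obtain x where "x \<in> simplex_grid r" "\<forall>y\<in>simplex_grid r. mpol_eval f x \<le> mpol_eval f y"
    using continuous_attains_inf[OF finite_imp_compact[OF finite_simplex_grid[OF assms]] _
        continuous_on_mpol_eval] by blast
  then show thesis
    by (intro that[of x] min_on_eqI) auto
qed

end

theory Submission imports Defs begin

text \<open>
  Fix \<open>x\<close> in the simplex and throw \<open>r\<close> balls independently into \<open>n\<close> boxes, box \<open>i\<close> having
  probability \<open>x $ i\<close>. The vector \<open>Y\<^sub>r\<close> of box counts is multinomially distributed, and
  \<open>Y\<^sub>r / r\<close> lies on the grid, so homogeneity of \<open>f\<close> gives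
  \<open>r\<^sup>3 min\<^bsub>\<Delta>(n,r)\<^esub> f \<le> E f(Y\<^sub>r)\<close>. The right-hand side is \<open>r\<^sup>3\<close> times the Bernstein
  approximation of \<open>f\<close> at \<open>x\<close>, and an upper bound for it bounds the minimum over the grid.

  For cubic \<open>f\<close> the expectation is a polynomial in \<open>r\<close> of degree at most \<open>3\<close> that vanishes at
  \<open>r = 0\<close> and in which \<open>r\<^sup>3\<close> has coefficient \<open>f(x)\<close>. Interpolation at \<open>0, 1, 2\<close> therefore gives
  \<open>E f(Y\<^sub>r) = r(r-1)(r-2) f(x) + r(r-1)/2 E f(Y\<^sub>2) - r(r-2) E f(Y\<^sub>1)\<close>
  (lemma \<open>cubic_count_mean_interpolation\<close>). Both remaining expectations are controlled by the
  extreme values on the simplex: \<open>E f(Y\<^sub>2) \<le> 8 max f\<close> because \<open>Y\<^sub>2 / 2\<close> is a point of the simplex,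
  and \<open>E f(Y\<^sub>1) \<ge> min f\<close>. If \<open>x\<close> is a minimiser of \<open>f\<close>, these bounds give
  \<open>r\<^sup>3 (min\<^bsub>\<Delta>(n,r)\<^esub> f - min f) \<le> 4r(r-1) (max f - min f)\<close>. The hypothesis \<open>r \<ge> 2\<close> makes the
  coefficient of \<open>E f(Y\<^sub>1)\<close> nonpositive, so that its lower bound points the right way.
\<close>

section \<open>Means over multinomial counts\<close>

text \<open>
  For \<open>x\<close> in the simplex this is the expectation \<open>E g(Y\<^sub>r)\<close>. The recursion conditions on one
  ball, so that moments reduce to pointwise identities for a single throw.
\<close>

fun count_mean :: "real ^ 'n::finite \<Rightarrow> nat \<Rightarrow> (real ^ 'n \<Rightarrow> real) \<Rightarrow> real" where
  "count_mean x 0 g = g 0"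
| "count_mean x (Suc r) g = count_mean x r (\<lambda>y. \<Sum>i\<in>UNIV. x $ i * g (y + axis i 1))"

definition count_vectors :: "nat \<Rightarrow> (real ^ 'n::finite) set" where
  "count_vectors r = {y. (\<forall>i. y $ i \<in> \<nat>) \<and> (\<Sum>i\<in>UNIV. y $ i) = real r}"

lemma count_mean_add:
  "count_mean x r (\<lambda>y. g y + h y) = count_mean x r g + count_mean x r h"
  by (induction r arbitrary: g h) (simp_all add: distrib_left sum.distrib)

lemma count_mean_cmult: "count_mean x r (\<lambda>y. c * g y) = c * count_mean x r g"
proof (induction r arbitrary: g)
  case (Suc r)
  have "(\<lambda>y. \<Sum>i\<in>UNIV. x $ i * (c * g (y + axis i 1)))
      = (\<lambda>y. c * (\<Sum>i\<in>UNIV. x $ i * g (y + axis i 1)))"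
    by (simp add: sum_distrib_left mult.left_commute)
  then show ?case
    by (simp add: Suc)
qed simp

lemma count_mean_const:
  assumes "(\<Sum>i\<in>UNIV. x $ i) = 1"
  shows "count_mean x r (\<lambda>y. c) = c"
  using assms by (induction r) (simp_all flip: sum_distrib_right)

lemma count_mean_sum:
  assumes "finite A"
  shows "count_mean x r (\<lambda>y. \<Sum>m\<in>A. g m y) = (\<Sum>m\<in>A. count_mean x r (g m))"
  using assms
proof (induction A rule: finite_induct)
  case empty
  show ?case
    using count_mean_cmult[of x r 0 "\<lambda>_. 0"] by simp
qed (simp add: count_mean_add)

lemma count_vectors_add_axis:
  assumes "y \<in> count_vectors r"
  shows "y + axis i 1 \<in> count_vectors (Suc r)"
  using assms by (auto simp: count_vectors_def axis_def sum.distrib)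

lemma count_mean_mono:
  assumes "x \<in> std_simplex"
    and "\<And>y. y \<in> count_vectors r \<Longrightarrow> g y \<le> h y"
  shows "count_mean x r g \<le> count_mean x r h"
  using assms(2)
proof (induction r arbitrary: g h)
  case 0
  then show ?case
    by (simp add: count_vectors_def)
next
  case (Suc r)
  have "(\<Sum>i\<in>UNIV. x $ i * g (y + axis i 1)) \<le> (\<Sum>i\<in>UNIV. x $ i * h (y + axis i 1))"
    if "y \<in> count_vectors r" for y
    using assms(1) Suc.prems[OF count_vectors_add_axis[OF that]]
    by (intro sum_mono mult_left_mono) (auto simp: std_simplex_def)
  then show ?case
    by (simp add: Suc.IH)
qed

section \<open>Cubic moments\<close>

lemma count_mean_linear:
  assumes "(\<Sum>i\<in>UNIV. x $ i) = 1"
  shows "count_mean x r (\<lambda>y. y $ a) = real r * x $ a"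
proof (induction r)
  case (Suc r)
  have step: "(\<Sum>i\<in>UNIV. x $ i * (y + axis i 1) $ a) = y $ a + x $ a" for y
  proof -
    have "x $ i * (y + axis i 1) $ a = x $ i * y $ a + (if i = a then x $ a else 0)" for i
      by (auto simp: axis_def algebra_simps)
    then show ?thesis
      using assms by (simp add: sum.distrib flip: sum_distrib_right)
  qed
  then show ?case
    by (simp only: count_mean.simps step Suc count_mean_add count_mean_const[OF assms])
      (simp add: algebra_simps)
qed simp

lemma count_mean_quadratic:
  assumes "(\<Sum>i\<in>UNIV. x $ i) = 1"
  shows "count_mean x r (\<lambda>y. y $ a * y $ b)
    = real r * (real r - 1) * (x $ a * x $ b) + real r * (of_bool (a = b) * x $ a)"
proof (induction r)
  case (Suc r)
  have step: "(\<Sum>i\<in>UNIV. x $ i * ((y + axis i 1) $ a * (y + axis i 1) $ b))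
      = y $ a * y $ b + (x $ a * y $ b + (x $ b * y $ a + of_bool (a = b) * x $ a))" for y
  proof -
    have "x $ i * ((y + axis i 1) $ a * (y + axis i 1) $ b)
        = x $ i * (y $ a * y $ b) + ((if i = a then x $ a * y $ b else 0)
          + ((if i = b then x $ b * y $ a else 0)
          + (if i = a then of_bool (a = b) * x $ a else 0)))" for i
      by (auto simp: axis_def algebra_simps)
    then show ?thesis
      using assms by (simp add: sum.distrib flip: sum_distrib_right)
  qed
  then show ?case
    by (simp only: count_mean.simps step Suc count_mean_add count_mean_const[OF assms] count_mean_linear[OF assms]
        count_mean_cmult)
      (simp add: algebra_simps)
qed simp

text \<open>
  Writing each count as a sum of indicators over the balls, the mean becomes a sum over triples
  of balls. The three terms collect the triples of pairwise distinct balls, those with exactly two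
  different balls, and those repeating a single ball; coinciding balls lie in the same box.
\<close>

lemma count_mean_cubic:
  assumes "(\<Sum>i\<in>UNIV. x $ i) = 1"
  shows "count_mean x r (\<lambda>y. y $ a * y $ b * y $ c)
    = real r * (real r - 1) * (real r - 2) * (x $ a * x $ b * x $ c)
      + real r * (real r - 1) * (of_bool (a = b) * x $ a * x $ c
        + of_bool (a = c) * x $ a * x $ b + of_bool (b = c) * x $ b * x $ a)
      + real r * (of_bool (a = b \<and> b = c) * x $ a)"
proof (induction r)
  case (Suc r)
  have step: "(\<Sum>i\<in>UNIV. x $ i * ((y + axis i 1) $ a * (y + axis i 1) $ b * (y + axis i 1) $ c))
      = y $ a * y $ b * y $ c + (x $ a * (y $ b * y $ c) + (x $ b * (y $ a * y $ c)
        + (x $ c * (y $ a * y $ b) + (of_bool (a = b) * x $ a * y $ c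
        + (of_bool (a = c) * x $ a * y $ b + (of_bool (b = c) * x $ b * y $ a
        + of_bool (a = b \<and> b = c) * x $ a))))))" for y
  proof -
    have "x $ i * ((y + axis i 1) $ a * (y + axis i 1) $ b * (y + axis i 1) $ c)
        = x $ i * (y $ a * y $ b * y $ c) + ((if i = a then x $ a * (y $ b * y $ c) else 0)
          + ((if i = b then x $ b * (y $ a * y $ c) else 0)
          + ((if i = c then x $ c * (y $ a * y $ b) else 0)
          + ((if i = a then of_bool (a = b) * x $ a * y $ c else 0)
          + ((if i = a then of_bool (a = c) * x $ a * y $ b else 0)
          + ((if i = b then of_bool (b = c) * x $ b * y $ a else 0)
          + (if i = a then of_bool (a = b \<and> b = c) * x $ a else 0)))))))" for i
      by (auto simp: axis_def algebra_simps)
    then show ?thesis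
      using assms by (simp add: sum.distrib flip: sum_distrib_right)
  qed
  then show ?case
    by (simp only: count_mean.simps step Suc count_mean_add count_mean_const[OF assms] count_mean_linear[OF assms]
        count_mean_quadratic[OF assms] count_mean_cmult)
      (simp add: algebra_simps)
qed simp

section \<open>Homogeneous cubics\<close>

lemma monomial_split_variable:
  fixes k :: "'n::finite \<Rightarrow> nat"
  assumes "(\<Sum>i\<in>UNIV. k i) = Suc d"
  obtains a l where "(\<Sum>i\<in>UNIV. l i) = d"
    and "\<And>y :: real ^ 'n. (\<Prod>i\<in>UNIV. (y $ i) ^ k i) = y $ a * (\<Prod>i\<in>UNIV. (y $ i) ^ l i)"
proof -
  obtain a where a: "k a \<noteq> 0"
    using assms by (metis sum.neutral nat.distinct(1))
  define l where "l = k(a := k a - 1)"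
  have "(\<Sum>i\<in>UNIV. k i) = k a + (\<Sum>i\<in>UNIV - {a}. l i)"
    by (simp add: sum.remove[of UNIV a] l_def)
  moreover have "(\<Sum>i\<in>UNIV. l i) = (k a - 1) + (\<Sum>i\<in>UNIV - {a}. l i)"
    by (simp add: sum.remove[of UNIV a] l_def)
  ultimately have "(\<Sum>i\<in>UNIV. l i) = d"
    using assms a by simp
  moreover have "(\<Prod>i\<in>UNIV. (y $ i) ^ k i) = y $ a * (\<Prod>i\<in>UNIV. (y $ i) ^ l i)"
    for y :: "real ^ 'n"
  proof -
    have "(y $ a) ^ k a = y $ a * (y $ a) ^ (k a - 1)"
      using a by (cases "k a") auto
    then show ?thesis
      by (simp add: prod.remove[of UNIV a] l_def)
  qed
  ultimately show thesis
    by (rule that)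
qed

lemma cubic_monomial_as_product:
  fixes k :: "'n::finite \<Rightarrow> nat"
  assumes "(\<Sum>i\<in>UNIV. k i) = 3"
  obtains a b c where "\<And>y :: real ^ 'n. (\<Prod>i\<in>UNIV. (y $ i) ^ k i) = y $ a * y $ b * y $ c"
proof -
  have deg1: "(\<Sum>i\<in>UNIV. k i) = Suc 2"
    using assms by simp
  obtain a k1 where 1: "(\<Sum>i\<in>UNIV. k1 i) = 2"
      "\<And>y :: real ^ 'n. (\<Prod>i\<in>UNIV. (y $ i) ^ k i) = y $ a * (\<Prod>i\<in>UNIV. (y $ i) ^ k1 i)"
    by (rule monomial_split_variable[OF deg1]) (rule that)
  have deg2: "(\<Sum>i\<in>UNIV. k1 i) = Suc 1"
    using 1(1) by simp
  obtain b k2 where 2: "(\<Sum>i\<in>UNIV. k2 i) = 1"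
      "\<And>y :: real ^ 'n. (\<Prod>i\<in>UNIV. (y $ i) ^ k1 i) = y $ b * (\<Prod>i\<in>UNIV. (y $ i) ^ k2 i)"
    by (rule monomial_split_variable[OF deg2]) (rule that)
  have deg3: "(\<Sum>i\<in>UNIV. k2 i) = Suc 0"
    using 2(1) by simp
  obtain c k3 where 3: "(\<Sum>i\<in>UNIV. k3 i) = 0"
      "\<And>y :: real ^ 'n. (\<Prod>i\<in>UNIV. (y $ i) ^ k2 i) = y $ c * (\<Prod>i\<in>UNIV. (y $ i) ^ k3 i)"
    by (rule monomial_split_variable[OF deg3]) (rule that)
  show thesis
    using 1(2) 2(2) 3 by (intro that[of a b c]) simp
qed

text \<open>
  In the mean of a monomial, the terms for exactly two different balls and for a single repeated
  ball are two unknowns that the values at \<open>r = 1\<close> and \<open>r = 2\<close> determine; the identity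
  eliminates them and, being linear in the monomial, passes to all cubic forms. Expressed through
  means instead of coefficients, these terms can be bounded by values of \<open>f\<close> on the simplex.
\<close>

lemma cubic_count_mean_interpolation:
  fixes x :: "real ^ 'n::finite"
  assumes "f \<in> hom_polys 3" and x: "(\<Sum>i\<in>UNIV. x $ i) = 1"
  shows "count_mean x r (mpol_eval f)
    = real r * (real r - 1) * (real r - 2) * mpol_eval f x
      + real r * (real r - 1) / 2 * count_mean x 2 (mpol_eval f)
      - real r * (real r - 2) * count_mean x 1 (mpol_eval f)"
proof -
  define p where "p m y = (\<Prod>i\<in>UNIV. (y $ i) ^ Poly_Mapping.lookup m i)"
    for m :: "'n \<Rightarrow>\<^sub>0 nat" and y :: "real ^ 'n"
  let ?K = "Poly_Mapping.keys f" and ?c = "Poly_Mapping.lookup f"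
  have f: "mpol_eval f = (\<lambda>y. \<Sum>m\<in>?K. ?c m * p m y)"
    by (simp add: mpol_eval_def p_def fun_eq_iff)
  have E: "count_mean x s (mpol_eval f) = (\<Sum>m\<in>?K. ?c m * count_mean x s (p m))" for s
    by (simp add: f count_mean_sum count_mean_cmult)
  have monomial: "count_mean x r (p m) = real r * (real r - 1) * (real r - 2) * p m x
      + real r * (real r - 1) / 2 * count_mean x 2 (p m)
      - real r * (real r - 2) * count_mean x 1 (p m)" if m: "m \<in> ?K" for m
  proof -
    have "(\<Sum>i\<in>UNIV. Poly_Mapping.lookup m i) = 3"
      using assms(1) m by (simp add: hom_polys_def)
    then obtain a b c where "p m = (\<lambda>y. y $ a * y $ b * y $ c)"
      using cubic_monomial_as_product unfolding p_def by (metis (no_types, lifting) ext)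
    then show ?thesis
      by (simp only: count_mean_cubic[OF x]) (simp add: field_simps)
  qed
  have "count_mean x r (mpol_eval f)
      = (\<Sum>m\<in>?K. real r * (real r - 1) * (real r - 2) * (?c m * p m x)
          + real r * (real r - 1) / 2 * (?c m * count_mean x 2 (p m))
          - real r * (real r - 2) * (?c m * count_mean x 1 (p m)))"
    unfolding E by (intro sum.cong refl) (simp only: monomial, simp only: algebra_simps)
  also have "\<dots> = real r * (real r - 1) * (real r - 2) * mpol_eval f x
      + real r * (real r - 1) / 2 * count_mean x 2 (mpol_eval f)
      - real r * (real r - 2) * count_mean x 1 (mpol_eval f)"
    unfolding E unfolding f by (simp only: sum.distrib sum_subtractf sum_distrib_left)
  finally show ?thesis .
qed

lemma mpol_eval_scaleR:
  assumes "f \<in> hom_polys d"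
  shows "mpol_eval f (t *\<^sub>R y) = t ^ d * mpol_eval f y"
proof -
  have "(\<Prod>i\<in>UNIV. ((t *\<^sub>R y) $ i) ^ Poly_Mapping.lookup m i)
      = t ^ d * (\<Prod>i\<in>UNIV. (y $ i) ^ Poly_Mapping.lookup m i)"
    if "m \<in> Poly_Mapping.keys f" for m
    using assms that by (simp add: hom_polys_def power_mult_distrib prod.distrib flip: power_sum)
  then show ?thesis
    by (simp add: mpol_eval_def sum_distrib_left mult.left_commute[of _ "t ^ d"])
qed

lemma count_vector_scaled_in_grid:
  assumes "y \<in> count_vectors r" and "r \<ge> 1"
  shows "(1 / real r) *\<^sub>R y \<in> simplex_grid r"
  using assms
  by (auto simp: count_vectors_def simplex_grid_def std_simplex_def Nats_altdef2
      simp flip: sum_divide_distrib)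

lemma mpol_eval_count_vector:
  assumes "f \<in> hom_polys d" and "r \<ge> 1"
  shows "mpol_eval f y = real r ^ d * mpol_eval f ((1 / real r) *\<^sub>R y)"
  by (subst mpol_eval_scaleR[OF assms(1), symmetric]) (use assms(2) in simp)

lemma count_mean_ge_of_grid_ge:
  assumes "x \<in> std_simplex" and "f \<in> hom_polys d" and "r \<ge> 1"
    and "\<And>y. y \<in> simplex_grid r \<Longrightarrow> v \<le> mpol_eval f y"
  shows "real r ^ d * v \<le> count_mean x r (mpol_eval f)"
proof -
  have "count_mean x r (\<lambda>_. real r ^ d * v) \<le> count_mean x r (mpol_eval f)"
    by (rule count_mean_mono[OF assms(1)], subst mpol_eval_count_vector[OF assms(2,3)])
      (intro mult_left_mono assms(4) count_vector_scaled_in_grid assms(3); simp)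
  then show ?thesis
    using assms(1) by (simp add: count_mean_const std_simplex_def)
qed

lemma count_mean_le_of_grid_le:
  assumes "x \<in> std_simplex" and "f \<in> hom_polys d" and "r \<ge> 1"
    and "\<And>y. y \<in> simplex_grid r \<Longrightarrow> mpol_eval f y \<le> v"
  shows "count_mean x r (mpol_eval f) \<le> real r ^ d * v"
proof -
  have "count_mean x r (mpol_eval f) \<le> count_mean x r (\<lambda>_. real r ^ d * v)"
    by (rule count_mean_mono[OF assms(1)], subst mpol_eval_count_vector[OF assms(2,3)])
      (intro mult_left_mono assms(4) count_vector_scaled_in_grid assms(3); simp)
  then show ?thesis
    using assms(1) by (simp add: count_mean_const std_simplex_def)
qed

section \<open>The grid error for cubics\<close>

theorem corollary2:
  fixes f :: "'n::finite mpol" and r :: nat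
  assumes "f \<in> hom_polys 3"
    and "r \<ge> 2"
  shows "min_on (mpol_eval f) (simplex_grid r) - min_on (mpol_eval f) std_simplex
    \<le> (4 / real r - 4 / (real r)^2)
      * (max_on (mpol_eval f) std_simplex - min_on (mpol_eval f) std_simplex)"
proof -
  define g m M where "g = min_on (mpol_eval f) (simplex_grid r)"
    and "m = min_on (mpol_eval f) std_simplex" and "M = max_on (mpol_eval f) std_simplex"
  note defs = g_def m_def M_def
  have g: "g \<le> mpol_eval f y" if "y \<in> simplex_grid r" for y
    by (rule min_on_simplex_grid_attained[of r f]) (use assms(2) that in \<open>auto simp: g_def\<close>)
  have M: "mpol_eval f y \<le> M" if "y \<in> std_simplex" for y
    by (rule max_on_std_simplex_attained[of f]) (use that in \<open>auto simp: M_def\<close>)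
  obtain x where x: "x \<in> std_simplex" "mpol_eval f x = m"
    and m: "\<And>y. y \<in> std_simplex \<Longrightarrow> m \<le> mpol_eval f y"
    by (rule min_on_std_simplex_attained[of f]) (simp add: m_def)
  have grid: "y \<in> std_simplex" if "y \<in> simplex_grid s" for y :: "real ^ 'n" and s
    using that by (simp add: simplex_grid_def)
  let ?R = "real r"
  have R: "?R \<ge> 2"
    using assms(2) by simp
  have "?R ^ 3 * g \<le> count_mean x r (mpol_eval f)"
    using assms(2) by (intro count_mean_ge_of_grid_ge[OF x(1) assms(1)] g) auto
  also have "\<dots> = ?R * (?R - 1) * (?R - 2) * m
      + ?R * (?R - 1) / 2 * count_mean x 2 (mpol_eval f)
      - ?R * (?R - 2) * count_mean x 1 (mpol_eval f)"
    using x by (subst cubic_count_mean_interpolation[OF assms(1)]) (auto simp: std_simplex_def)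
  also have "\<dots> \<le> ?R * (?R - 1) * (?R - 2) * m + ?R * (?R - 1) / 2 * (8 * M) - ?R * (?R - 2) * m"
  proof -
    have "count_mean x 2 (mpol_eval f) \<le> 8 * M"
      using count_mean_le_of_grid_le[OF x(1) assms(1), of 2 M] M grid by auto
    moreover have "m \<le> count_mean x 1 (mpol_eval f)"
      using count_mean_ge_of_grid_ge[OF x(1) assms(1), of 1 m] m grid by auto
    ultimately show ?thesis
      using R by (intro diff_mono add_left_mono mult_left_mono) auto
  qed
  finally have "?R ^ 3 * (g - m) \<le> 4 * ?R * (?R - 1) * (M - m)"
    by (simp add: field_simps power3_eq_cube)
  also have "\<dots> = ?R ^ 3 * ((4 / ?R - 4 / ?R ^ 2) * (M - m))"
    using R by (simp add: field_simps power3_eq_cube power2_eq_square)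
  finally show ?thesis
    using R by (simp add: defs mult_le_cancel_left_pos)
qed

end
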